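(* Let $N\ge 2$. The complete family $\mathfrak W=\bigsqcup_{(k',k)\in\Lambda}\mathfrak W_{k',k}\subset\Lambda\times\mathbf P^3$ of chiral Potts rapidity curves is isomorphic, via the projection $\Lambda\times\mathbf P^3\to\mathbf P^3$, to the Fermat surface $$\{[a,b,c,d]\in\mathbf P^3 : a^{2N}+c^{2N}=b^{2N}+d^{2N}\}.$$ In particular the projection $\mathfrak W\to\Lambda$ corresponds under this isomorphism to a fibration $\pi$ of the Fermat surface over $\Lambda$.
   Context: Varieties are over $\mathbf C$. $\Lambda=\{(k',k): k^2+k'^2=1\}$ denotes the projective conic $\{[k',k,l]\in\mathbf P^2: k'^2+k^2=l^2\}\cong\mathbf P^1$ (affine points have $l=1$; the two points with $l=0$ are written $(k',k)=(\infty,\infty_\pm)$, where $ik/k'=\pm1$). For $[k',k,l]\in\Lambda$, the rapidity curve $\mathfrak W_{k',k}\subset\mathbf P^3$ is defined by the four equations $ka^N+k'c^N=l d^N$, $kb^N+k'd^N=l c^N$, $l a^N+k'b^N=kd^N$, $k'a^N+l b^N=kc^N$. In particular the degenerate fibres are: $\mathfrak W_{0,\pm1}: a^N=\pm d^N,\ b^N=\pm c^N$; $\mathfrak W_{\pm1,0}: c^N=\pm d^N,\ a^N=\mp b^N$; $\mathfrak W_{\infty,\infty_\pm}: a^N=\mp i c^N,\ b^N=\mp i d^N$. *)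

theory Defs
  imports "HOL-Analysis.Analysis"
begin

section \<open>Projective space over the complex numbers\<close>

text \<open>A point of \<open>'n proj\<close> is a nonzero vector of $\mathbf{C}^n$ up to scaling, so
  \<open>3 proj\<close> is the projective plane and \<open>4 proj\<close> is projective three-space.\<close>

definition proportional :: "complex ^ 'n \<Rightarrow> complex ^ 'n \<Rightarrow> bool" where
  "proportional v w \<longleftrightarrow> v \<noteq> 0 \<and> w \<noteq> 0 \<and> (\<exists>c. w = c *s v)"

lemma part_equivp_proportional:
  "part_equivp (proportional :: complex ^ 'n::finite \<Rightarrow> complex ^ 'n \<Rightarrow> bool)"
proof (rule part_equivpI)
  have "(1 :: complex ^ 'n) \<noteq> 0"
    by (simp add: vec_eq_iff)
  then have "proportional (1 :: complex ^ 'n) 1"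
    by (auto simp: proportional_def intro: exI[of _ 1])
  then show "\<exists>v :: complex ^ 'n. proportional v v" ..
  show "symp (proportional :: complex ^ 'n \<Rightarrow> complex ^ 'n \<Rightarrow> bool)"
  proof (rule sympI)
    fix v w :: "complex ^ 'n"
    assume "proportional v w"
    then obtain c where c: "v \<noteq> 0" "w \<noteq> 0" "w = c *s v"
      unfolding proportional_def by blast
    then have "c \<noteq> 0"
      by auto
    then have "v = inverse c *s w"
      unfolding c(3) by (simp add: vector_smult_assoc)
    with c(1,2) show "proportional w v"
      unfolding proportional_def by blast
  qed
  show "transp (proportional :: complex ^ 'n \<Rightarrow> complex ^ 'n \<Rightarrow> bool)"
    unfolding proportional_def by (rule transpI) (metis vector_smult_assoc)
qed

quotient_type 'n proj = "complex ^ 'n::finite" / partial: proportional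
  by (rule part_equivp_proportional)

text \<open>\<^term>\<open>rep_proj p\<close> is some choice of homogeneous coordinates of \<open>p\<close>.  Below it only occurs in
  homogeneous equations and in quotients of forms of equal degree, which do not depend on
  the choice.\<close>

section \<open>Forms\<close>

inductive homogeneous :: "nat \<Rightarrow> (complex ^ 'n \<Rightarrow> complex) \<Rightarrow> bool" where
  const: "homogeneous 0 (\<lambda>_. c)"
| coord: "homogeneous 1 (\<lambda>x. x $ i)"
| add: "homogeneous d f \<Longrightarrow> homogeneous d g \<Longrightarrow> homogeneous d (\<lambda>x. f x + g x)"
| mult: "homogeneous d f \<Longrightarrow> homogeneous e g \<Longrightarrow> homogeneous (d + e) (\<lambda>x. f x * g x)"

inductive bihomogeneous ::
    "nat \<times> nat \<Rightarrow> (complex ^ 'm \<Rightarrow> complex ^ 'n \<Rightarrow> complex) \<Rightarrow> bool" where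
  const: "bihomogeneous (0, 0) (\<lambda>_ _. c)"
| coord1: "bihomogeneous (1, 0) (\<lambda>x _. x $ i)"
| coord2: "bihomogeneous (0, 1) (\<lambda>_ y. y $ j)"
| add: "bihomogeneous (d, e) f \<Longrightarrow> bihomogeneous (d, e) g \<Longrightarrow>
    bihomogeneous (d, e) (\<lambda>x y. f x y + g x y)"
| mult: "bihomogeneous (d, e) f \<Longrightarrow> bihomogeneous (d', e') g \<Longrightarrow>
    bihomogeneous (d + d', e + e') (\<lambda>x y. f x y * g x y)"

definition proj_forms :: "nat \<Rightarrow> ('n::finite proj \<Rightarrow> complex) set" where
  "proj_forms d = {\<lambda>p. f (rep_proj p) | f. homogeneous d f}"

definition biproj_forms ::
    "nat \<times> nat \<Rightarrow> ('m::finite proj \<times> 'n::finite proj \<Rightarrow> complex) set" where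
  "biproj_forms D = {\<lambda>(p, q). f (rep_proj p) (rep_proj q) | f. bihomogeneous D f}"

lemma homogeneous_scale: "homogeneous d f \<Longrightarrow> f (c *s x) = c ^ d * f x"
  by (induction rule: homogeneous.induct) (auto simp: algebra_simps power_add)

lemma bihomogeneous_scale:
  "bihomogeneous D f \<Longrightarrow> f (b *s x) (c *s y) = b ^ fst D * c ^ snd D * f x y"
  by (induction rule: bihomogeneous.induct) (auto simp: algebra_simps power_add)

section \<open>Varieties and morphisms\<close>

text \<open>A (classical) variety is treated as a space with functions: its Zariski topology
  together with the regular functions on each open set.  Only the values on \<open>U\<close> of a function
  in \<open>regular X U\<close> are significant.\<close>

record 'p variety =
  zariski :: "'p topology"
  regular :: "'p set \<Rightarrow> ('p \<Rightarrow> complex) set"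

abbreviation points :: "'p variety \<Rightarrow> 'p set" where
  "points X \<equiv> topspace (zariski X)"

text \<open>The argument \<open>G\<close> gives the forms of each degree on the ambient space.  The nonvanishing loci
  of forms are a base of the ambient Zariski topology, and a function is regular if it is
  locally a quotient of two forms of the same degree.\<close>

definition ambient_zariski :: "('i \<Rightarrow> ('p \<Rightarrow> complex) set) \<Rightarrow> 'p topology" where
  "ambient_zariski G = topology_generated_by {{p. s p \<noteq> 0} | s i. s \<in> G i}"

definition subvariety :: "('i \<Rightarrow> ('p \<Rightarrow> complex) set) \<Rightarrow> 'p set \<Rightarrow> 'p variety" where
  "subvariety G S = \<lparr>
     zariski = subtopology (ambient_zariski G) S,
     regular = (\<lambda>U. {\<phi>. \<forall>p\<in>U. \<exists>V. openin (subtopology (ambient_zariski G) S) V \<and> p \<in> V \<and> V \<subseteq> U \<and>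
       (\<exists>i. \<exists>s\<in>G i. \<exists>t\<in>G i. \<forall>q\<in>V. t q \<noteq> 0 \<and> \<phi> q = s q / t q)})\<rparr>"

definition morphism :: "'p variety \<Rightarrow> 'q variety \<Rightarrow> ('p \<Rightarrow> 'q) \<Rightarrow> bool" where
  "morphism X Y f \<longleftrightarrow> continuous_map (zariski X) (zariski Y) f \<and>
     (\<forall>V \<phi>. openin (zariski Y) V \<longrightarrow> \<phi> \<in> regular Y V \<longrightarrow>
        \<phi> \<circ> f \<in> regular X {x \<in> points X. f x \<in> V})"

definition isomorphism :: "'p variety \<Rightarrow> 'q variety \<Rightarrow> ('p \<Rightarrow> 'q) \<Rightarrow> bool" where
  "isomorphism X Y f \<longleftrightarrow> morphism X Y f \<and>
     (\<exists>g. morphism Y X g \<and> (\<forall>x\<in>points X. g (f x) = x) \<and> (\<forall>y\<in>points Y. f (g y) = y))"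

definition fibration :: "'p variety \<Rightarrow> 'q variety \<Rightarrow> ('p \<Rightarrow> 'q) \<Rightarrow> bool" where
  "fibration X Y f \<longleftrightarrow> morphism X Y f \<and> f ` points X = points Y \<and>
     (\<forall>y\<in>points Y. connectedin (zariski X) {x \<in> points X. f x = y})"

section \<open>Rapidity curves and the Fermat surface\<close>

text \<open>The homogeneous coordinates are $[k',k,l]$ on the plane and $[a,b,c,d]$ on three-space,
  in this order.\<close>

definition Lambda :: "3 proj set" where
  "Lambda = {p. let k' = rep_proj p $ 1; k = rep_proj p $ 2; l = rep_proj p $ 3
     in k'^2 + k^2 = l^2}"

definition rapidity_curve :: "nat \<Rightarrow> 3 proj \<Rightarrow> 4 proj set" where
  "rapidity_curve N p = {q.
     let k' = rep_proj p $ 1; k = rep_proj p $ 2; l = rep_proj p $ 3;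
         a = rep_proj q $ 1; b = rep_proj q $ 2; c = rep_proj q $ 3; d = rep_proj q $ 4
     in k * a^N + k' * c^N = l * d^N \<and>
        k * b^N + k' * d^N = l * c^N \<and>
        l * a^N + k' * b^N = k * d^N \<and>
        k' * a^N + l * b^N = k * c^N}"

definition conic_variety :: "3 proj variety" where
  "conic_variety = subvariety proj_forms Lambda"

definition rapidity_family :: "nat \<Rightarrow> (3 proj \<times> 4 proj) variety" where
  "rapidity_family N = subvariety biproj_forms (SIGMA p:Lambda. rapidity_curve N p)"

definition fermat_surface :: "nat \<Rightarrow> 4 proj variety" where
  "fermat_surface N = subvariety proj_forms {q.
     let a = rep_proj q $ 1; b = rep_proj q $ 2; c = rep_proj q $ 3; d = rep_proj q $ 4
     in a^(2*N) + c^(2*N) = b^(2*N) + d^(2*N)}"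

end

theory Submission
  imports Defs
begin

text \<open>Put \<open>X = (a^N, b^N, c^N, d^N)\<close>. The equations of the rapidity curve are four linear equations for
  \<open>[k', k, l]\<close> with coefficients in \<open>X\<close>. They have a nonzero solution on the conic exactly if \<open>X\<close>
  satisfies the Fermat equation, and then the system has rank two, so that the solution is unique and
  given locally by the cross product of two of its rows. Hence the family is the graph of a morphism \<open>\<pi>\<close>
  from the Fermat surface to the conic.

  For fixed \<open>[k', k, l]\<close> the vectors \<open>X\<close> form a linear subspace which has a nonzero point on every
  coordinate hyperplane. The cone over the fibre of \<open>\<pi>\<close> is the preimage of this subspace without the
  origin under the coordinatewise \<open>N\<close>-th power, and such a preimage is connected in the classical
  topology, because the deck group is generated by elements which fix points. The Zariski topology is
  coarser, so the fibres of \<open>\<pi>\<close> are connected.\<close>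

section \<open>Connectedness of power covers\<close>

lemma vec_power_nth [simp]: "(x ^ m) $ i = (x $ i) ^ m" for x :: "'a::comm_ring_1 ^ 'n"
  by (induction m) auto

lemma continuous_on_vec_mult:
  fixes f g :: "'a::topological_space \<Rightarrow> complex ^ 'n"
  assumes "continuous_on S f" "continuous_on S g"
  shows "continuous_on S (\<lambda>x. f x * g x)"
proof -
  have eq: "(\<lambda>x. f x * g x) = (\<lambda>x. \<chi> i. f x $ i * g x $ i)"
    by (auto simp: vec_eq_iff)
  show ?thesis
    unfolding eq by (intro continuous_intros assms)
qed

lemma continuous_on_vec_power:
  fixes f :: "'a::topological_space \<Rightarrow> complex ^ 'n"
  assumes "continuous_on S f"
  shows "continuous_on S (\<lambda>x. f x ^ m)"
  by (induction m) (auto intro: continuous_on_vec_mult assms)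

section \<open>Properness of the coordinatewise power map\<close>

lemma norm_le_of_norm_power_le:
  fixes z :: "'a::real_normed_div_algebra"
  assumes "norm (z ^ N) \<le> B" "N > 0"
  shows "norm z \<le> max 1 B"
proof (cases "norm z \<le> 1")
  case False
  then have "norm z \<le> norm z ^ N"
    using assms(2) by (intro self_le_power) auto
  then show ?thesis
    using assms(1) by (simp add: norm_power)
qed auto

text \<open>If the powers converge, they are bounded, hence so are their roots coordinate by
  coordinate. A subsequence of the roots then converges inside \<open>K\<close>, and its limit is a
  root of the given limit.\<close>

lemma closed_power_image:
  fixes K :: "(complex ^ 'n) set"
  assumes "closed K" "N > 0"
  shows "closed ((\<lambda>x. x ^ N) ` K)"
  unfolding closed_sequential_limits
proof (intro allI impI, elim conjE)
  fix y l
  assume y: "\<forall>n. y n \<in> (\<lambda>x. x ^ N) ` K" and lim: "y \<longlonglongrightarrow> l"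
  then have "\<forall>n. \<exists>x. x \<in> K \<and> y n = x ^ N"
    by blast
  then obtain x where x: "\<And>n. x n \<in> K" "\<And>n. y n = x n ^ N"
    by metis
  obtain B where B: "\<And>n. norm (y n) \<le> B"
    using convergent_imp_bounded[OF lim] unfolding bounded_iff by auto
  have "norm (x n $ i) \<le> max 1 B" for n i
    using Finite_Cartesian_Product.norm_nth_le[of "y n" i] B[of n] x(2)[of n] assms(2)
    by (intro norm_le_of_norm_power_le[of _ N]) auto
  then have "norm (x n) \<le> real CARD('n) * max 1 B" for n
    unfolding norm_vec_def by (intro order_trans[OF L2_set_le_sum] sum_bounded_above) auto
  then have "bounded (range x)"
    unfolding bounded_iff by auto
  then obtain z r where r: "strict_mono r" "(x \<circ> r) \<longlonglongrightarrow> z"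
    using bounded_imp_convergent_subsequence by blast
  have "z \<in> K"
    using closed_sequentially[OF assms(1) _ r(2)] x(1) by simp
  have "continuous_on UNIV (\<lambda>v :: complex ^ 'n. v ^ N)"
    by (intro continuous_on_vec_power continuous_on_id)
  then have "(\<lambda>n. (x \<circ> r) n ^ N) \<longlonglongrightarrow> z ^ N"
    by (rule continuous_on_tendsto_compose[OF _ r(2)]) auto
  moreover have "(\<lambda>n. (x \<circ> r) n ^ N) \<longlonglongrightarrow> l"
    using LIMSEQ_subseq_LIMSEQ[OF lim r(1)] x(2) by (simp add: o_def)
  ultimately have "z ^ N = l"
    by (rule LIMSEQ_unique)
  with \<open>z \<in> K\<close> show "l \<in> (\<lambda>x. x ^ N) ` K" by auto
qed

section \<open>The deck group of the power map\<close>

lemma finite_vec_roots_unity: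
  assumes "N > 0"
  shows "finite {g :: complex ^ 'n. g ^ N = 1}"
proof (rule finite_subset)
  show "{g :: complex ^ 'n. g ^ N = 1} \<subseteq> vec_lambda ` (UNIV \<rightarrow>\<^sub>E {z. z ^ N = 1})"
  proof
    fix g :: "complex ^ 'n" assume "g \<in> {g. g ^ N = 1}"
    then have "(g $ i) ^ N = 1" for i
      using vec_power_nth[of g N i] by simp
    then show "g \<in> vec_lambda ` (UNIV \<rightarrow>\<^sub>E {z. z ^ N = 1})"
      by (intro image_eqI[of _ _ "vec_nth g"]) auto
  qed
  show "finite (vec_lambda ` (UNIV \<rightarrow>\<^sub>E {z :: complex. z ^ N = 1}) :: (complex ^ 'n) set)"
    using finite_roots_unity[of N] assms by (intro finite_imageI finite_PiE) auto
qed

lemma ex_vec_root: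
  assumes "N > 0"
  obtains x :: "complex ^ 'n" where "x ^ N = y"
proof -
  have "\<exists>z. z ^ N = y $ i" for i
    using exists_complex_root[of N "y $ i"] assms by (metis not_gr_zero)
  then obtain f where "\<And>i. f i ^ N = y $ i" by metis
  then have "(\<chi> i. f i) ^ N = y"
    by (simp add: vec_eq_iff)
  then show thesis by (rule that)
qed

text \<open>Transitivity of the deck group on fibres: nonzero coordinates with equal powers differ
  by a root of unity, their quotient.\<close>

lemma vec_power_eq_imp:
  fixes x z :: "complex ^ 'n"
  assumes "x ^ N = z ^ N" "N > 0"
  obtains g where "g ^ N = 1" "x = g * z"
proof
  \<comment> \<open>Where \<open>z $ i = 0\<close>, also \<open>x $ i = 0\<close>, so any root of
    unity would do there; the value 1 is chosen.\<close>
  let ?g = "\<chi> i. if z $ i = 0 then 1 else x $ i / z $ i"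
  have *: "(x $ i) ^ N = (z $ i) ^ N" for i
    using assms(1) by (metis vec_power_nth)
  show "?g ^ N = 1"
    using * by (auto simp: vec_eq_iff power_divide)
  have "x $ i = 0" if "z $ i = 0" for i
    using *[of i] that assms(2) by (simp add: power_0_left)
  then show "x = ?g * z"
    by (auto simp: vec_eq_iff)
qed

text \<open>\<open>h\<close> is the product of its one-coordinate factors, so invariance can be
  accumulated one coordinate at a time. The truncations of \<open>h\<close> must stay in
  \<open>G\<close> for this.\<close>

lemma coordinatewise_invariant:
  fixes P :: "'a::comm_ring_1 ^ 'n \<Rightarrow> bool"
  assumes "\<And>i h x. x \<in> X \<Longrightarrow> h \<in> G \<Longrightarrow> (\<forall>j. j \<noteq> i \<longrightarrow> h $ j = 1) \<Longrightarrow> P (h * x) = P x"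
    and "\<And>h x. x \<in> X \<Longrightarrow> h \<in> G \<Longrightarrow> h * x \<in> X"
    and "\<And>h J. h \<in> G \<Longrightarrow> (\<chi> j. if j \<in> J then h $ j else 1) \<in> G"
    and "x \<in> X" "h \<in> G"
  shows "P (h * x) = P x"
proof -
  let ?h = "\<lambda>J. \<chi> j. if j \<in> J then h $ j else 1"
  have "P (?h I * x) = P x" if "finite I" for I
    using that
  proof induction
    case empty
    have "?h {} = 1" by (simp add: vec_eq_iff)
    then show ?case by simp
  next
    case (insert i I)
    then have "?h (insert i I) * x = ?h {i} * (?h I * x)"
      by (auto simp: vec_eq_iff)
    moreover have "P (?h {i} * (?h I * x)) = P (?h I * x)"
      using assms(2,4) assms(3)[OF assms(5), of "{i}"] assms(3)[OF assms(5), of I]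
      by (intro assms(1)[of _ _ i]) auto
    ultimately show ?case
      using insert by simp
  qed
  from this[of UNIV] show ?thesis by simp
qed

text \<open>The group \<open>\<mu>\<^sub>N\<^sup>n\<close> acts transitively on the fibres of the \<open>N\<close>-th power map, and a point on the
  \<open>i\<close>-th coordinate hyperplane is fixed by the \<open>i\<close>-th factor.  So if all pieces of a clopen partition
  permuted by the group meet that hyperplane, then the \<open>i\<close>-th factor preserves every piece.\<close>

theorem connected_power_vimage:
  fixes Y :: "(complex ^ 'n) set"
  assumes "N > 0" "connected Y" and meets: "\<And>i. \<exists>y\<in>Y. y $ i = 0"
  shows "connected {x. x ^ N \<in> Y}"
proof -
  define X where "X = {x :: complex ^ 'n. x ^ N \<in> Y}"
  define G where "G = {g :: complex ^ 'n. g ^ N = 1}"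
  define T where "T = top_of_set X"
  have finG: "finite G"
    using assms(1) finite_vec_roots_unity unfolding G_def by blast
  have one: "1 \<in> G"
    by (simp add: G_def)
  have mult: "g * h \<in> G" if "g \<in> G" "h \<in> G" for g h
    using that by (simp add: G_def power_mult_distrib)
  have act: "g * x \<in> X" if "g \<in> G" "x \<in> X" for g x
    using that by (simp add: G_def X_def power_mult_distrib)
  have topT [simp]: "topspace T = X"
    by (simp add: T_def)
  have cont: "continuous_map T T (\<lambda>x. g * x)" if "g \<in> G" for g
    using that act unfolding T_def
    by (auto intro!: continuous_on_vec_mult continuous_intros)
  have vimage: "openin T {x \<in> X. g * x \<in> U} \<and> closedin T {x \<in> X. g * x \<in> U}"
    if "g \<in> G" "openin T U" "closedin T U" for g U
    using openin_continuous_map_preimage[OF cont that(2)]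
      closedin_continuous_map_preimage[OF cont that(3)] that(1) by simp
  \<comment> \<open>Since \<open>X\<close> is a full preimage, the image of
    \<open>X \<inter> C\<close> is \<open>Y\<close> intersected with the image of \<open>C\<close>,
    so the restricted power map is still closed.\<close>
  have image: "closedin (top_of_set Y) ((\<lambda>x. x ^ N) ` K)" if K: "closedin T K" for K
  proof -
    obtain C where "closed C" "K = X \<inter> C"
      using K unfolding T_def closedin_closed by blast
    moreover from this have "(\<lambda>x. x ^ N) ` K = Y \<inter> (\<lambda>x. x ^ N) ` C"
      by (auto simp: X_def)
    ultimately show ?thesis
      using closed_power_image[OF _ assms(1)] unfolding closedin_closed by blast
  qed
  \<comment> \<open>Every orbit meets every nonempty clopen set. Otherwise the saturation
    \<open>S\<close> of \<open>U\<close> and its complement would have nonempty disjoint closed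
    images covering \<open>Y\<close>.\<close>
  have orbit: "\<exists>g\<in>G. g * x \<in> U"
    if U: "openin T U" "closedin T U" "U \<noteq> {}" and x: "x \<in> X" for U x
  proof (rule ccontr)
    assume no: "\<not> ?thesis"
    define S where "S = (\<Union>g\<in>G. {x \<in> X. g * x \<in> U})"
    have S: "openin T S" "closedin T S"
      unfolding S_def using vimage U finG by (auto intro!: closedin_Union)
    have "U \<subseteq> S"
      using one closedin_subset[OF U(2)] by (force simp: S_def)
    have "closedin T (X - S)"
      using S(1) by (metis closedin_diff closedin_topspace topT)
    have "Y \<subseteq> (\<lambda>x. x ^ N) ` X"
    proof
      fix y assume "y \<in> Y"
      moreover obtain x where "x ^ N = y"
        using ex_vec_root[OF assms(1)] by metis
      ultimately show "y \<in> (\<lambda>x. x ^ N) ` X"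
        by (auto simp: X_def)
    qed
    then have "Y \<subseteq> (\<lambda>x. x ^ N) ` S \<union> (\<lambda>x. x ^ N) ` (X - S)"
      by blast
    \<comment> \<open>Points with equal powers lie in one orbit, and \<open>S\<close> is a union of
      orbits.\<close>
    moreover have "(\<lambda>x. x ^ N) ` S \<inter> (\<lambda>x. x ^ N) ` (X - S) = {}"
    proof (rule ccontr)
      assume "\<not> ?thesis"
      then obtain s z where sz: "s \<in> S" "z \<in> X - S" "s ^ N = z ^ N"
        by (auto simp: image_def)
      then obtain h where "h ^ N = 1" and sh: "s = h * z"
        using vec_power_eq_imp[OF sz(3) assms(1)] by metis
      then have h: "h \<in> G"
        by (simp add: G_def)
      obtain g where "g \<in> G" "g * s \<in> U"
        using sz(1) by (auto simp: S_def)
      then have "g * h \<in> G" "(g * h) * z \<in> U"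
        using h sh mult by (auto simp: mult.assoc)
      then have "z \<in> S"
        using sz(2) by (auto simp: S_def)
      then show False
        using sz(2) by blast
    qed
    moreover have "(\<lambda>x. x ^ N) ` S \<noteq> {}" "(\<lambda>x. x ^ N) ` (X - S) \<noteq> {}"
      using \<open>U \<subseteq> S\<close> U(3) no x by (auto simp: S_def)
    ultimately show False
      using assms(2) image[OF S(2)] image[OF \<open>closedin T (X - S)\<close>]
      unfolding connected_closedin by blast
  qed
  have "U = {} \<or> U = X" if U: "openin T U" "closedin T U" for U
  proof (rule disjCI)
    assume "U \<noteq> X"
    have "U \<subseteq> X"
      using closedin_subset[OF U(2)] by simp
    have inv: "(h * x \<in> U) = (x \<in> U)"
      if x: "x \<in> X" and h: "h \<in> G" "\<forall>j. j \<noteq> i \<longrightarrow> h $ j = 1" for i h x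
    proof -
      \<comment> \<open>\<open>P\<close> collects the points lying in the same translates of
        \<open>U\<close> as \<open>x\<close>. It is clopen as a finite intersection, so it contains
        some \<open>g * z\<close> with vanishing \<open>i\<close>-th coordinate. That point is fixed
        by \<open>h\<close>, and comparing membership for the group elements \<open>h\<close> and
        \<open>1\<close> transfers the invariance to \<open>x\<close>.\<close>
      define P where "P = (\<Inter>g\<in>G. {z \<in> X. (g * z \<in> U) = (g * x \<in> U)})"
      have "openin T {z \<in> X. (g * z \<in> U) = (g * x \<in> U)} \<and>
          closedin T {z \<in> X. (g * z \<in> U) = (g * x \<in> U)}" if "g \<in> G" for g
      proof (cases "g * x \<in> U")
        case True
        then show ?thesis using vimage[OF that U] by simp
      next
        case False
        then have eq: "{z \<in> X. (g * z \<in> U) = (g * x \<in> U)} = topspace T - {z \<in> X. g * z \<in> U}"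
          by auto
        show ?thesis
          unfolding eq using vimage[OF that U] by blast
      qed
      then have "openin T P" "closedin T P"
        unfolding P_def using finG one by (auto intro!: openin_Inter closedin_Inter)
      moreover have "x \<in> P"
        using x by (auto simp: P_def)
      moreover obtain y where y: "y \<in> Y" "y $ i = 0"
        using meets by blast
      moreover obtain z where z: "z ^ N = y"
        using ex_vec_root[OF assms(1)] by metis
      ultimately obtain g where g: "g \<in> G" "g * z \<in> P"
        using orbit[of P z] by (auto simp: X_def)
      have "(z $ i) ^ N = 0"
        using z y(2) by (metis vec_power_nth)
      then have "z $ i = 0" by simp
      then have "(h * (g * z)) $ j = (g * z) $ j" for j
        using h(2) by (cases "j = i") auto
      then have "h * (g * z) = g * z"
        by (simp add: vec_eq_iff)
      then have "(h * x \<in> U) = (g * z \<in> U)" "(x \<in> U) = (g * z \<in> U)"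
        using g(2) h(1) one unfolding P_def by force+
      then show ?thesis by simp
    qed
    have inv': "(h * x \<in> U) = (x \<in> U)" if "x \<in> X" "h \<in> G" for x h
      by (rule coordinatewise_invariant[of X G "\<lambda>x. x \<in> U"])
        (use inv act that in \<open>auto simp: G_def vec_eq_iff\<close>)
    show "U = {}"
    proof (rule ccontr)
      assume "U \<noteq> {}"
      then have "X \<subseteq> U"
        using orbit[OF U] inv' by blast
      with \<open>U \<subseteq> X\<close> \<open>U \<noteq> X\<close> show False by blast
    qed
  qed
  then have "connected X"
    unfolding connected_clopen T_def by blast
  then show ?thesis
    by (simp add: X_def)
qed

section \<open>Morphisms given by forms\<close>

lemma points_subvariety:
  assumes "topspace (ambient_zariski G) = UNIV"
  shows "points (subvariety G S) = S"
  using assms by (simp add: subvariety_def)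

lemma openin_nonvanishing:
  assumes "s \<in> G i"
  shows "openin (ambient_zariski G) {p. s p \<noteq> 0}"
  unfolding ambient_zariski_def using assms by (intro topology_generated_by_Basis) auto

lemma openin_subtopology_nonvanishing:
  assumes "s \<in> G i"
  shows "openin (subtopology (ambient_zariski G) S) {p \<in> S. s p \<noteq> 0}"
proof -
  have "{p \<in> S. s p \<noteq> 0} = {p. s p \<noteq> 0} \<inter> S"
    by auto
  then show ?thesis
    using openin_subtopology_Int[OF openin_nonvanishing[of s G i, OF assms]] by simp
qed

lemma topspace_ambient_zariski:
  assumes "(\<lambda>_. 1) \<in> G i"
  shows "topspace (ambient_zariski G) = UNIV"
  using openin_subset[OF openin_nonvanishing[of _ G i, OF assms]] by auto

lemma continuous_map_into_ambient_zariski: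
  assumes "f \<in> topspace X \<rightarrow> topspace (ambient_zariski H)"
    and "\<And>s i. s \<in> H i \<Longrightarrow> openin X {x \<in> topspace X. s (f x) \<noteq> 0}"
  shows "continuous_map X (ambient_zariski H) f"
  unfolding ambient_zariski_def
proof (rule continuous_on_generated_topo)
  fix U assume "U \<in> {{p. s p \<noteq> 0} |s i. s \<in> H i}"
  then obtain s i where "s \<in> H i" "U = {p. s p \<noteq> 0}"
    by blast
  moreover from this have "f -` U \<inter> topspace X = {x \<in> topspace X. s (f x) \<noteq> 0}"
    by auto
  ultimately show "openin X (f -` U \<inter> topspace X)"
    using assms(2) by simp
next
  show "f ` topspace X \<subseteq> \<Union> {{p. s p \<noteq> 0} |s i. s \<in> H i}"
    using assms(1) unfolding ambient_zariski_def topology_generated_by_topspace by blast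
qed

text \<open>The unit \<open>u\<close> may depend on the degree \<open>i\<close> but not on the form \<open>s\<close>, so that it cancels in
  quotients of forms of equal degree.\<close>

lemma morphism_subvarietyI:
  fixes G :: "'i \<Rightarrow> ('p \<Rightarrow> complex) set" and H :: "'j \<Rightarrow> ('q \<Rightarrow> complex) set"
  assumes G: "topspace (ambient_zariski G) = UNIV" and H: "topspace (ambient_zariski H) = UNIV"
    and maps: "f \<in> S \<rightarrow> T"
    and pullback: "\<And>p. p \<in> S \<Longrightarrow>
      \<exists>W. openin (subtopology (ambient_zariski G) S) W \<and> p \<in> W \<and>
        (\<forall>j. \<exists>i u. (\<forall>q\<in>W. u q \<noteq> 0) \<and> (\<forall>s\<in>H j. \<exists>t\<in>G i. \<forall>q\<in>W. s (f q) = u q * t q))"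
  shows "morphism (subvariety G S) (subvariety H T) f"
proof -
  define ZG where "ZG = subtopology (ambient_zariski G) S"
  define ZH where "ZH = subtopology (ambient_zariski H) T"
  have top [simp]: "topspace ZG = S" "topspace ZH = T"
    using G H by (simp_all add: ZG_def ZH_def)
  have "openin ZG {x \<in> S. s (f x) \<noteq> 0}" if s: "s \<in> H j" for s j
  proof (subst openin_subopen, intro ballI)
    fix p assume "p \<in> {x \<in> S. s (f x) \<noteq> 0}"
    then have p: "p \<in> S" "s (f p) \<noteq> 0" by auto
    obtain W where W: "openin ZG W" "p \<in> W"
      "\<forall>j. \<exists>i u. (\<forall>q\<in>W. u q \<noteq> 0) \<and> (\<forall>s\<in>H j. \<exists>t\<in>G i. \<forall>q\<in>W. s (f q) = u q * t q)"
      using pullback[OF p(1)] unfolding ZG_def by blast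
    obtain i u t where t: "t \<in> G i" "\<forall>q\<in>W. u q \<noteq> 0 \<and> s (f q) = u q * t q"
      using W(3) s by blast
    have "openin ZG {q \<in> S. t q \<noteq> 0}"
      unfolding ZG_def by (rule openin_subtopology_nonvanishing[of t G i, OF t(1)])
    \<comment> \<open>On \<open>W\<close> the factor \<open>u\<close> has no zeros, so
      \<open>s (f q)\<close> and \<open>t q\<close> vanish together.\<close>
    then have "openin ZG (W \<inter> {q \<in> S. t q \<noteq> 0})"
      using W(1) by (rule openin_Int[rotated])
    moreover have "p \<in> W \<inter> {q \<in> S. t q \<noteq> 0}"
      using W(2) t(2) p by auto
    moreover have "W \<inter> {q \<in> S. t q \<noteq> 0} \<subseteq> {x \<in> S. s (f x) \<noteq> 0}"
      using t(2) by auto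
    ultimately show "\<exists>V. openin ZG V \<and> p \<in> V \<and> V \<subseteq> {x \<in> S. s (f x) \<noteq> 0}"
      by blast
  qed
  then have cont: "continuous_map ZG ZH f"
    using maps H unfolding ZH_def
    by (auto intro!: continuous_map_into_subtopology continuous_map_into_ambient_zariski)
  have "\<phi> \<circ> f \<in> regular (subvariety G S) {x \<in> S. f x \<in> V}"
    if V: "openin ZH V" and \<phi>: "\<phi> \<in> regular (subvariety H T) V" for V \<phi>
    unfolding subvariety_def variety.simps mem_Collect_eq ZG_def[symmetric]
  proof
    fix p assume p: "p \<in> {x \<in> S. f x \<in> V}"
    have "\<forall>y\<in>V. \<exists>V'. openin ZH V' \<and> y \<in> V' \<and> V' \<subseteq> V \<and>
        (\<exists>j. \<exists>s\<in>H j. \<exists>t\<in>H j. \<forall>q\<in>V'. t q \<noteq> 0 \<and> \<phi> q = s q / t q)"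
      using \<phi> by (simp add: subvariety_def ZH_def)
    moreover have "f p \<in> V" "p \<in> S"
      using p by auto
    ultimately have "\<exists>V'. openin ZH V' \<and> f p \<in> V' \<and> V' \<subseteq> V \<and>
        (\<exists>j. \<exists>s\<in>H j. \<exists>t\<in>H j. \<forall>q\<in>V'. t q \<noteq> 0 \<and> \<phi> q = s q / t q)"
      by simp
    then obtain V' j s t where V': "openin ZH V'" "f p \<in> V'" "V' \<subseteq> V"
      and st: "s \<in> H j" "t \<in> H j" "\<forall>q\<in>V'. t q \<noteq> 0 \<and> \<phi> q = s q / t q"
      by (elim exE conjE bexE) (rule that)
    obtain W where W: "openin ZG W" "p \<in> W"
      "\<forall>j. \<exists>i u. (\<forall>q\<in>W. u q \<noteq> 0) \<and> (\<forall>s\<in>H j. \<exists>t\<in>G i. \<forall>q\<in>W. s (f q) = u q * t q)"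
      using pullback[OF \<open>p \<in> S\<close>] unfolding ZG_def by blast
    \<comment> \<open>One pair \<open>i\<close>, \<open>u\<close> must serve both numerator and
      denominator, so it is fixed before either form is pulled back; then \<open>u\<close>
      cancels.\<close>
    obtain i u s' t' where u: "\<forall>q\<in>W. u q \<noteq> 0" and "s' \<in> G i" "\<forall>q\<in>W. s (f q) = u q * s' q"
      "t' \<in> G i" "\<forall>q\<in>W. t (f q) = u q * t' q"
    proof -
      obtain i u where "\<forall>q\<in>W. u q \<noteq> 0"
        "\<forall>s\<in>H j. \<exists>t\<in>G i. \<forall>q\<in>W. s (f q) = u q * t q"
        using W(3) by blast
      with st(1,2) show thesis
        using that by blast
    qed
    then have "\<forall>q\<in>W \<inter> {x \<in> S. f x \<in> V'}. t' q \<noteq> 0 \<and> (\<phi> \<circ> f) q = s' q / t' q"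
      using st(3) by auto
    moreover have "openin ZG (W \<inter> {x \<in> S. f x \<in> V'})"
      using openin_continuous_map_preimage[OF cont V'(1)] W(1) by auto
    ultimately show "\<exists>V''. openin ZG V'' \<and> p \<in> V'' \<and> V'' \<subseteq> {x \<in> S. f x \<in> V} \<and>
        (\<exists>i. \<exists>s\<in>G i. \<exists>t\<in>G i. \<forall>q\<in>V''. t q \<noteq> 0 \<and> (\<phi> \<circ> f) q = s q / t q)"
      using p V' W(2) \<open>s' \<in> G i\<close> \<open>t' \<in> G i\<close>
      by (intro exI[of _ "W \<inter> {x \<in> S. f x \<in> V'}"]) blast
  qed
  then show ?thesis
    using cont points_subvariety[OF G] unfolding morphism_def
    by (simp add: subvariety_def ZG_def ZH_def)
qed

text \<open>The case \<open>W = S\<close>, \<open>u = 1\<close> of the local criterion, suited to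
  the two projections of a product.\<close>

lemma morphism_subvariety_globalI:
  fixes G :: "'i \<Rightarrow> ('p \<Rightarrow> complex) set" and H :: "'j \<Rightarrow> ('q \<Rightarrow> complex) set"
  assumes G: "topspace (ambient_zariski G) = UNIV" and H: "topspace (ambient_zariski H) = UNIV"
    and maps: "f \<in> S \<rightarrow> T"
    and pullback: "\<And>j s. s \<in> H j \<Longrightarrow> s \<circ> f \<in> G (r j)"
  shows "morphism (subvariety G S) (subvariety H T) f"
proof (rule morphism_subvarietyI[OF G H maps])
  fix p assume "p \<in> S"
  moreover have "openin (subtopology (ambient_zariski G) S) S"
    using openin_topspace[of "subtopology (ambient_zariski G) S"] G by simp
  moreover have "\<forall>s\<in>H j. \<exists>t\<in>G (r j). \<forall>q\<in>S. s (f q) = 1 * t q" for j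
  proof
    fix s assume "s \<in> H j"
    then show "\<exists>t\<in>G (r j). \<forall>q\<in>S. s (f q) = 1 * t q"
      using pullback by (intro bexI[of _ "s \<circ> f"]) auto
  qed
  then have "\<exists>i u. (\<forall>q\<in>S. u q \<noteq> 0) \<and> (\<forall>s\<in>H j. \<exists>t\<in>G i. \<forall>q\<in>S. s (f q) = u q * t q)" for j
    by (intro exI[of _ "r j"] exI[of _ "\<lambda>_. 1"]) auto
  ultimately show "\<exists>W. openin (subtopology (ambient_zariski G) S) W \<and> p \<in> W \<and>
      (\<forall>j. \<exists>i u. (\<forall>q\<in>W. u q \<noteq> 0) \<and> (\<forall>s\<in>H j. \<exists>t\<in>G i. \<forall>q\<in>W. s (f q) = u q * t q))"
    by blast
qed

lemma morphism_compose:
  assumes f: "morphism X Y f" and g: "morphism Y Z g"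
  shows "morphism X Z (g \<circ> f)"
proof -
  have "\<phi> \<circ> (g \<circ> f) \<in> regular X {x \<in> points X. (g \<circ> f) x \<in> V}"
    if "openin (zariski Z) V" "\<phi> \<in> regular Z V" for V \<phi>
  proof -
    let ?V = "{y \<in> points Y. g y \<in> V}"
    have "openin (zariski Y) ?V" "\<phi> \<circ> g \<in> regular Y ?V"
      using g that unfolding morphism_def by (auto intro: openin_continuous_map_preimage)
    then have "(\<phi> \<circ> g) \<circ> f \<in> regular X {x \<in> points X. f x \<in> ?V}"
      using f unfolding morphism_def by blast
    moreover have "{x \<in> points X. f x \<in> ?V} = {x \<in> points X. (g \<circ> f) x \<in> V}"
      using f unfolding morphism_def by (auto dest: continuous_map_image_subset_topspace)
    ultimately show ?thesis
      by (simp add: o_assoc)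
  qed
  then show ?thesis
    using f g unfolding morphism_def by (auto intro: continuous_map_compose)
qed

section \<open>Forms on products\<close>

lemma proj_formsI: "homogeneous d f \<Longrightarrow> (\<lambda>p. f (rep_proj p)) \<in> proj_forms d"
  unfolding proj_forms_def mem_Collect_eq by (rule exI[of _ f]) simp

lemma biproj_formsI:
  "bihomogeneous D f \<Longrightarrow> (\<lambda>(p, q). f (rep_proj p) (rep_proj q)) \<in> biproj_forms D"
  unfolding biproj_forms_def mem_Collect_eq by (rule exI[of _ f]) simp

lemma topspace_proj_forms [simp]: "topspace (ambient_zariski proj_forms) = UNIV"
proof (rule topspace_ambient_zariski)
  show "(\<lambda>_. 1) \<in> proj_forms 0"
    unfolding proj_forms_def by (auto intro!: exI[of _ "\<lambda>_. 1"] homogeneous.const)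
qed

lemma topspace_biproj_forms [simp]: "topspace (ambient_zariski biproj_forms) = UNIV"
proof (rule topspace_ambient_zariski)
  show "(\<lambda>_. 1) \<in> biproj_forms (0, 0)"
    unfolding biproj_forms_def by (auto intro!: exI[of _ "\<lambda>_ _. 1"] bihomogeneous.const)
qed

lemma bihomogeneous_of_homogeneous_left:
  "homogeneous d f \<Longrightarrow> bihomogeneous (d, 0) (\<lambda>x y. f x)"
proof (induction rule: homogeneous.induct)
  case (mult d f e g)
  then show ?case using bihomogeneous.mult[of d 0 _ e 0] by simp
qed (use bihomogeneous.intros in auto)

lemma bihomogeneous_of_homogeneous_right:
  "homogeneous d f \<Longrightarrow> bihomogeneous (0, d) (\<lambda>x y. f y)"
proof (induction rule: homogeneous.induct)
  case (mult d f e g)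
  then show ?case using bihomogeneous.mult[of 0 d _ 0 e] by simp
qed (use bihomogeneous.intros in auto)

text \<open>Each first-factor variable is replaced by a form of degree \<open>m\<close> and so
  contributes \<open>m\<close> to the degree; second-factor variables keep contributing 1.\<close>

lemma homogeneous_compose_graph:
  assumes "bihomogeneous D f" "\<And>i. homogeneous m (\<lambda>x. w x $ i)"
  shows "homogeneous (m * fst D + snd D) (\<lambda>x. f (w x) x)"
  using assms(1)
proof (induction rule: bihomogeneous.induct)
  case (const c)
  show ?case using homogeneous.const by simp
next
  case (coord1 i)
  show ?case using assms(2) by simp
next
  case (coord2 j)
  show ?case using homogeneous.coord by simp
next
  case (add d e f g)
  then show ?case using homogeneous.add by simp
next
  case (mult d e f d' e' g)
  then have "homogeneous ((m * d + e) + (m * d' + e')) (\<lambda>x. f (w x) x * g (w x) x)"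
    using homogeneous.mult by simp
  then show ?case by (simp add: algebra_simps)
qed

lemma homogeneous_power: "homogeneous d f \<Longrightarrow> homogeneous (n * d) (\<lambda>x. f x ^ n)"
proof (induction n)
  case 0
  show ?case using homogeneous.const[of 1] by simp
next
  case (Suc n)
  then show ?case using homogeneous.mult[of d f "n * d" "\<lambda>x. f x ^ n"] by simp
qed

lemma homogeneous_diff:
  assumes "homogeneous d f" "homogeneous d g"
  shows "homogeneous d (\<lambda>x. f x - g x)"
proof -
  have "homogeneous d (\<lambda>x. - 1 * g x)"
    using homogeneous.mult[OF homogeneous.const[of "- 1"] assms(2)] by simp
  then show ?thesis
    using homogeneous.add[OF assms(1)] by fastforce
qed

lemma homogeneous_continuous_on: "homogeneous d f \<Longrightarrow> continuous_on S f"
  by (induction rule: homogeneous.induct) (auto intro!: continuous_intros)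

lemma morphism_fst:
  fixes S :: "('m::finite proj \<times> 'n::finite proj) set"
  assumes "fst \<in> S \<rightarrow> T"
  shows "morphism (subvariety biproj_forms S) (subvariety proj_forms T) fst"
proof (rule morphism_subvariety_globalI[OF _ _ assms])
  fix d and s :: "'m proj \<Rightarrow> complex" assume "s \<in> proj_forms d"
  then obtain f where f: "homogeneous d f" "s = (\<lambda>p. f (rep_proj p))"
    unfolding proj_forms_def by blast
  have eq: "(s \<circ> fst :: 'm proj \<times> 'n proj \<Rightarrow> complex) = (\<lambda>(p, q). f (rep_proj p))"
    using f(2) by auto
  show "(s \<circ> fst :: 'm proj \<times> 'n proj \<Rightarrow> complex) \<in> biproj_forms (d, 0)"
    unfolding eq by (rule biproj_formsI[OF bihomogeneous_of_homogeneous_left[OF f(1)]])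
qed auto

lemma morphism_snd:
  fixes S :: "('m::finite proj \<times> 'n::finite proj) set"
  assumes "snd \<in> S \<rightarrow> T"
  shows "morphism (subvariety biproj_forms S) (subvariety proj_forms T) snd"
proof (rule morphism_subvariety_globalI[OF _ _ assms])
  fix d and s :: "'n proj \<Rightarrow> complex" assume "s \<in> proj_forms d"
  then obtain f where f: "homogeneous d f" "s = (\<lambda>p. f (rep_proj p))"
    unfolding proj_forms_def by blast
  have eq: "(s \<circ> snd :: 'm proj \<times> 'n proj \<Rightarrow> complex) = (\<lambda>(p, q). f (rep_proj q))"
    using f(2) by auto
  show "(s \<circ> snd :: 'm proj \<times> 'n proj \<Rightarrow> complex) \<in> biproj_forms (0, d)"
    unfolding eq by (rule biproj_formsI[OF bihomogeneous_of_homogeneous_right[OF f(1)]])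
qed auto

section \<open>Homogeneous coordinates\<close>

lemma rep_proj_nonzero: "rep_proj p \<noteq> 0"
  using Quotient3_rep_reflp[OF Quotient3_proj] unfolding proportional_def by blast

lemma rep_abs_proj:
  assumes "v \<noteq> 0"
  obtains c where "c \<noteq> 0" "rep_proj (abs_proj v) = c *s v"
proof -
  have "proportional v v"
    using assms unfolding proportional_def by (metis vector_smult_lid)
  then have "proportional v (rep_proj (abs_proj v))"
    using rep_abs_rsp[OF Quotient3_proj] by blast
  then show thesis
    using that unfolding proportional_def by (metis vector_smult_lzero)
qed

lemma abs_proj_eqI:
  assumes "v \<noteq> 0" "v = c *s w"
  shows "abs_proj v = abs_proj w"
proof -
  have "w \<noteq> 0" using assms by auto
  then have "proportional w v" "proportional w w" "proportional v v"
    using assms unfolding proportional_def by (metis vector_smult_lid)+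
  then show ?thesis
    using Quotient3_rel[OF Quotient3_proj] by metis
qed

lemma abs_rep_proj: "abs_proj (rep_proj p) = p"
  by (rule Quotient3_abs_rep[OF Quotient3_proj])

text \<open>Near each point \<open>\<pi>\<close> is given by forms of one degree, so pulling a
  bihomogeneous form back along the graph gives a form up to a unit. That unit comes from the choice
  of coordinates of \<open>\<pi> q\<close>.\<close>

lemma morphism_graph:
  fixes S :: "'n::finite proj set" and \<pi> :: "'n proj \<Rightarrow> 'm::finite proj"
  assumes maps: "(\<lambda>q. (\<pi> q, q)) \<in> S \<rightarrow> T"
    and local: "\<And>p. p \<in> S \<Longrightarrow> \<exists>w m. (\<forall>i. homogeneous m (\<lambda>x. w x $ i)) \<and> w (rep_proj p) \<noteq> 0 \<and>
      (\<forall>q\<in>S. w (rep_proj q) \<noteq> 0 \<longrightarrow> \<pi> q = abs_proj (w (rep_proj q)))"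
  shows "morphism (subvariety proj_forms S) (subvariety biproj_forms T) (\<lambda>q. (\<pi> q, q))"
proof (rule morphism_subvarietyI[OF _ _ maps])
  fix p assume p: "p \<in> S"
  obtain w m where w: "\<And>i. homogeneous m (\<lambda>x. w x $ i)" "w (rep_proj p) \<noteq> 0"
    and \<pi>: "\<And>q. q \<in> S \<Longrightarrow> w (rep_proj q) \<noteq> 0 \<Longrightarrow> \<pi> q = abs_proj (w (rep_proj q))"
    using local[OF p] by blast
  obtain i where i: "w (rep_proj p) $ i \<noteq> 0"
    using w(2) by (auto simp: vec_eq_iff)
  define W where "W = {q \<in> S. w (rep_proj q) $ i \<noteq> 0}"
  have nz: "w (rep_proj q) \<noteq> 0" if "q \<in> W" for q
    using that by (auto simp: W_def)
  have "(\<lambda>q. w (rep_proj q) $ i) \<in> proj_forms m"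
    by (rule proj_formsI[OF w(1)])
  then have "openin (subtopology (ambient_zariski proj_forms) S) W"
    unfolding W_def by (rule openin_subtopology_nonvanishing[where G = proj_forms and i = m])
  moreover have "p \<in> W"
    using p i by (simp add: W_def)
  moreover have "\<forall>D. \<exists>d u. (\<forall>q\<in>W. u q \<noteq> 0) \<and>
      (\<forall>s\<in>biproj_forms D. \<exists>t\<in>proj_forms d. \<forall>q\<in>W. s (\<pi> q, q) = u q * t q)"
  proof
    fix D :: "nat \<times> nat"
    \<comment> \<open>\<open>c q\<close> compares the chosen coordinates of \<open>\<pi> q\<close>
      with \<open>w (rep_proj q)\<close>. It may vary wildly with \<open>q\<close>, but
      bihomogeneity extracts it as \<open>c q ^ fst D\<close>, the same factor for all forms of
      bidegree \<open>D\<close>.\<close>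
    have "\<forall>q\<in>W. \<exists>c. c \<noteq> 0 \<and> rep_proj (\<pi> q) = c *s w (rep_proj q)"
      using \<pi> nz rep_abs_proj by (metis (mono_tags, lifting) W_def mem_Collect_eq)
    then obtain c where c: "\<And>q. q \<in> W \<Longrightarrow> c q \<noteq> 0 \<and> rep_proj (\<pi> q) = c q *s w (rep_proj q)"
      by metis
    have "\<exists>t\<in>proj_forms (m * fst D + snd D). \<forall>q\<in>W. s (\<pi> q, q) = c q ^ fst D * t q"
      if s: "s \<in> biproj_forms D" for s :: "'m proj \<times> 'n proj \<Rightarrow> complex"
    proof -
      obtain f where f: "bihomogeneous D f" "s = (\<lambda>(p, q). f (rep_proj p) (rep_proj q))"
        using s unfolding biproj_forms_def by blast
      have "s (\<pi> q, q) = c q ^ fst D * f (w (rep_proj q)) (rep_proj q)" if "q \<in> W" for q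
        using bihomogeneous_scale[OF f(1), of "c q" _ 1 "rep_proj q"] c[OF that] f(2) by simp
      then show ?thesis
        by (intro bexI[OF _ proj_formsI[OF homogeneous_compose_graph[OF f(1) w(1)]]]) auto
    qed
    then show "\<exists>d u. (\<forall>q\<in>W. u q \<noteq> 0) \<and>
        (\<forall>s\<in>biproj_forms D. \<exists>t\<in>proj_forms d. \<forall>q\<in>W. s (\<pi> q, q) = u q * t q)"
      using c by (intro exI[of _ "m * fst D + snd D"] exI[of _ "\<lambda>q. c q ^ fst D"]) auto
  qed
  ultimately show "\<exists>W. openin (subtopology (ambient_zariski proj_forms) S) W \<and> p \<in> W \<and>
      (\<forall>D. \<exists>d u. (\<forall>q\<in>W. u q \<noteq> 0) \<and>
        (\<forall>s\<in>biproj_forms D. \<exists>t\<in>proj_forms d. \<forall>q\<in>W. s (\<pi> q, q) = u q * t q))"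
    by blast
qed auto

text \<open>Forms are classically continuous, so nonvanishing loci pull back to classically open
  sets. This carries connectedness from the classical to the Zariski topology.\<close>

lemma continuous_map_abs_proj:
  assumes "0 \<notin> S"
  shows "continuous_map (top_of_set S) (ambient_zariski proj_forms) abs_proj"
proof (rule continuous_map_into_ambient_zariski)
  fix s :: "'a proj \<Rightarrow> complex" and d assume "s \<in> proj_forms d"
  then obtain f where f: "homogeneous d f" "s = (\<lambda>p. f (rep_proj p))"
    unfolding proj_forms_def by blast
  have "s (abs_proj x) \<noteq> 0 \<longleftrightarrow> f x \<noteq> 0" if "x \<in> S" for x
  proof -
    have "x \<noteq> 0" using that assms by auto
    then obtain c where "c \<noteq> 0" "rep_proj (abs_proj x) = c *s x"
      using rep_abs_proj by blast
    then show ?thesis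
      using homogeneous_scale[OF f(1), of c x] f(2) by simp
  qed
  then have "{x \<in> topspace (top_of_set S). s (abs_proj x) \<noteq> 0} = S \<inter> f -` (- {0})"
    by auto
  moreover have "openin (top_of_set S) (S \<inter> f -` (- {0}))"
    by (intro continuous_openin_preimage_gen homogeneous_continuous_on[OF f(1)]) auto
  ultimately show "openin (top_of_set S) {x \<in> topspace (top_of_set S). s (abs_proj x) \<noteq> 0}"
    by simp
qed auto

section \<open>The linear system of the rapidity curves\<close>

text \<open>\<open>k\<close> stands for \<open>[k', k, l]\<close> and \<open>X\<close> for the vector of \<open>N\<close>-th powers of \<open>[a, b, c, d]\<close>.\<close>

definition rapidity_eqs :: "complex ^ 3 \<Rightarrow> complex ^ 4 \<Rightarrow> bool" where
  "rapidity_eqs k X \<longleftrightarrow>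
     k $ 2 * X $ 1 + k $ 1 * X $ 3 = k $ 3 * X $ 4 \<and>
     k $ 2 * X $ 2 + k $ 1 * X $ 4 = k $ 3 * X $ 3 \<and>
     k $ 3 * X $ 1 + k $ 1 * X $ 2 = k $ 2 * X $ 4 \<and>
     k $ 1 * X $ 1 + k $ 3 * X $ 2 = k $ 2 * X $ 3"

definition on_conic :: "complex ^ 3 \<Rightarrow> bool" where
  "on_conic k \<longleftrightarrow> (k $ 1)\<^sup>2 + (k $ 2)\<^sup>2 = (k $ 3)\<^sup>2"

definition fermat_eq :: "complex ^ 4 \<Rightarrow> bool" where
  "fermat_eq X \<longleftrightarrow> (X $ 1)\<^sup>2 + (X $ 3)\<^sup>2 = (X $ 2)\<^sup>2 + (X $ 4)\<^sup>2"

text \<open>Up to sign, the cross products of two rows of the system \<open>rapidity_eqs\<close>, viewed as linear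
  equations for \<open>k\<close>.\<close>

definition row_products :: "(complex ^ 4 \<Rightarrow> complex ^ 3) set" where
  "row_products =
    {\<lambda>X. vector [X$2 * X$4 - X$1 * X$3, (X$3)\<^sup>2 - (X$4)\<^sup>2, X$2 * X$3 - X$1 * X$4],
     \<lambda>X. vector [(X$4)\<^sup>2 - (X$1)\<^sup>2, X$1 * X$3 + X$2 * X$4, X$1 * X$2 + X$3 * X$4],
     \<lambda>X. vector [X$3 * X$4 - X$1 * X$2, X$1 * X$4 + X$2 * X$3, (X$1)\<^sup>2 + (X$3)\<^sup>2]}"

lemma row_products_cases:
  assumes "v \<in> row_products"
  obtains
    "\<And>X. v X $ 1 = X$2 * X$4 - X$1 * X$3" "\<And>X. v X $ 2 = (X$3)\<^sup>2 - (X$4)\<^sup>2"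
      "\<And>X. v X $ 3 = X$2 * X$3 - X$1 * X$4"
  | "\<And>X. v X $ 1 = (X$4)\<^sup>2 - (X$1)\<^sup>2" "\<And>X. v X $ 2 = X$1 * X$3 + X$2 * X$4"
      "\<And>X. v X $ 3 = X$1 * X$2 + X$3 * X$4"
  | "\<And>X. v X $ 1 = X$3 * X$4 - X$1 * X$2" "\<And>X. v X $ 2 = X$1 * X$4 + X$2 * X$3"
      "\<And>X. v X $ 3 = (X$1)\<^sup>2 + (X$3)\<^sup>2"
  using assms unfolding row_products_def by auto

text \<open>The three vectors are, up to sign, the first row crossed with each of the other rows.
  Such a product is orthogonal to its two rows identically; the other two equations and the conic
  equation follow from the Fermat relation.\<close>

lemma row_product_solves:
  assumes "v \<in> row_products" "fermat_eq X"
  shows "rapidity_eqs (v X) X" "on_conic (v X)"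
proof -
  have X: "(X $ 1)\<^sup>2 = (X $ 2)\<^sup>2 + (X $ 4)\<^sup>2 - (X $ 3)\<^sup>2"
    using assms(2) by (simp add: fermat_eq_def algebra_simps)
  from assms(1) show "rapidity_eqs (v X) X"
  proof (cases rule: row_products_cases)
    case 1
    show ?thesis
      using 1[of X] X unfolding rapidity_eqs_def by (intro conjI) algebra+
  next
    case 2
    show ?thesis
      using 2[of X] X unfolding rapidity_eqs_def by (intro conjI) algebra+
  next
    case 3
    show ?thesis
      using 3[of X] X unfolding rapidity_eqs_def by (intro conjI) algebra+
  qed
  from assms(1) show "on_conic (v X)"
  proof (cases rule: row_products_cases)
    case 1
    show ?thesis
      using 1[of X] X unfolding on_conic_def by algebra
  next
    case 2
    show ?thesis
      using 2[of X] X unfolding on_conic_def by algebra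
  next
    case 3
    show ?thesis
      using 3[of X] X unfolding on_conic_def by algebra
  qed
qed

text \<open>One suitable coordinate of each product suffices: if these vanish, then
  \<open>X $ 1\<close>, \<open>X $ 3\<close>, \<open>X $ 4\<close> have equal squares and two of the
  squares sum to 0, so all three entries are 0. The Fermat equation then kills
  \<open>X $ 2\<close>.\<close>

lemma ex_row_product_nonzero:
  assumes "X \<noteq> 0" "fermat_eq X"
  shows "\<exists>v\<in>row_products. v X \<noteq> 0"
proof (rule ccontr)
  assume "\<not> ?thesis"
  then have v: "\<forall>v\<in>row_products. v X = 0"
    by blast
  have "(X $ 4)\<^sup>2 = (X $ 1)\<^sup>2" "(X $ 3)\<^sup>2 = (X $ 4)\<^sup>2" "(X $ 1)\<^sup>2 + (X $ 3)\<^sup>2 = 0"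
    using v unfolding row_products_def by (auto simp: vec_eq_iff forall_3)
  then have "(X $ 1)\<^sup>2 = 0 \<and> (X $ 2)\<^sup>2 = 0 \<and> (X $ 3)\<^sup>2 = 0 \<and> (X $ 4)\<^sup>2 = 0"
    using assms(2) by (simp add: fermat_eq_def)
  then show False
    using assms(1) by (simp add: vec_eq_iff forall_4)
qed

text \<open>A vector orthogonal to two rows is parallel to their cross product when that product is
  nonzero.\<close>

lemma rapidity_eqs_unique:
  assumes "rapidity_eqs k X" "v \<in> row_products" "v X \<noteq> 0"
  shows "\<exists>c. k = c *s v X"
proof -
  \<comment> \<open>Parallelism is expressed by the vanishing of all two-by-two minors.\<close>
  have *: "k $ i * v X $ j = k $ j * v X $ i" for i j
  proof -
    from assms(2) have "k $ 1 * v X $ 2 = k $ 2 * v X $ 1 \<and> k $ 1 * v X $ 3 = k $ 3 * v X $ 1 \<and>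
        k $ 2 * v X $ 3 = k $ 3 * v X $ 2"
    proof (cases rule: row_products_cases)
      case 1
      show ?thesis
        using 1[of X] assms(1)[unfolded rapidity_eqs_def] by (intro conjI) algebra+
    next
      case 2
      show ?thesis
        using 2[of X] assms(1)[unfolded rapidity_eqs_def] by (intro conjI) algebra+
    next
      case 3
      show ?thesis
        using 3[of X] assms(1)[unfolded rapidity_eqs_def] by (intro conjI) algebra+
    qed
    then show ?thesis
      using exhaust_3[of i] exhaust_3[of j] by auto
  qed
  obtain i where "v X $ i \<noteq> 0"
    using assms(3) by (auto simp: vec_eq_iff)
  then have "k = (k $ i / v X $ i) *s v X"
    using * by (simp add: vec_eq_iff field_simps)
  then show ?thesis ..
qed

text \<open>The Fermat defect \<open>?F\<close> is annihilated by the square of every coordinate of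
  \<open>k\<close>, one of which is nonzero.\<close>

lemma fermat_eq_of_rapidity_eqs:
  assumes "rapidity_eqs k X" "k \<noteq> 0" "on_conic k"
  shows "fermat_eq X"
proof -
  let ?F = "(X $ 1)\<^sup>2 + (X $ 3)\<^sup>2 - (X $ 2)\<^sup>2 - (X $ 4)\<^sup>2"
  have "(k $ 1)\<^sup>2 * ?F = 0" "(k $ 2)\<^sup>2 * ?F = 0" "(k $ 3)\<^sup>2 * ?F = 0"
    using assms(1,3) unfolding rapidity_eqs_def on_conic_def by algebra+
  moreover have "k $ 1 \<noteq> 0 \<or> k $ 2 \<noteq> 0 \<or> k $ 3 \<noteq> 0"
    using assms(2) by (simp add: vec_eq_iff forall_3)
  ultimately have "?F = 0"
    by auto
  then show ?thesis
    by (simp add: fermat_eq_def algebra_simps)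
qed

lemma rapidity_eqs_scale:
  assumes "b \<noteq> 0" "c \<noteq> 0"
  shows "rapidity_eqs (b *s k) (c *s X) \<longleftrightarrow> rapidity_eqs k X"
proof -
  have *: "b * x * (c * y) + b * z * (c * w) = b * s * (c * t) \<longleftrightarrow> x * y + z * w = s * t"
    for x y z w s t :: complex
  proof -
    have "b * x * (c * y) + b * z * (c * w) = (b * c) * (x * y + z * w)" "b * s * (c * t) = (b * c) * (s * t)"
      by (simp_all add: algebra_simps)
    then show ?thesis using assms by simp
  qed
  show ?thesis
    by (simp add: rapidity_eqs_def *)
qed

lemma on_conic_scale:
  assumes "b \<noteq> 0"
  shows "on_conic (b *s k) \<longleftrightarrow> on_conic k"
  using assms by (simp add: on_conic_def power_mult_distrib flip: distrib_left)

text \<open>Supplies the points on coordinate hyperplanes that \<open>connected_power_vimage\<close>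
  asks for, and hence also nonemptiness of the fibres.\<close>

lemma rapidity_eqs_hyperplane:
  assumes "on_conic k" "k \<noteq> 0"
  shows "\<exists>X. X \<noteq> 0 \<and> rapidity_eqs k X \<and> X $ i = 0"
proof -
  have k: "k $ 1 \<noteq> 0 \<or> k $ 2 \<noteq> 0 \<or> k $ 3 \<noteq> 0"
    using assms(2) by (simp add: vec_eq_iff forall_3)
  define P :: "complex \<Rightarrow> complex \<Rightarrow> complex \<Rightarrow> complex \<Rightarrow> complex ^ 4" where
    "P = (\<lambda>a b c d. \<chi> j. if j = 1 then a else if j = 2 then b else if j = 3 then c else d)"
  have P: "P a b c d $ 1 = a" "P a b c d $ 2 = b" "P a b c d $ 3 = c" "P a b c d $ 4 = d"
    for a b c d
    by (simp_all add: P_def)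
  \<comment> \<open>Setting one entry of \<open>X\<close> to 0 makes the remaining entries
    proportional to the coordinates of \<open>k\<close>, up to order and sign. One of the four
    equations then becomes the conic equation and the others cancel.\<close>
  have sys: "rapidity_eqs k (P 0 (k$2) (k$3) (k$1))" "rapidity_eqs k (P (k$2) 0 (k$1) (k$3))"
    "rapidity_eqs k (P (k$3) (- k$1) 0 (k$2))" "rapidity_eqs k (P (- k$1) (k$3) (k$2) 0)"
    using assms(1) unfolding rapidity_eqs_def on_conic_def P
    by (simp_all add: power2_eq_square algebra_simps)
  have nz: "P a b c d \<noteq> 0" if "a \<noteq> 0 \<or> b \<noteq> 0 \<or> c \<noteq> 0 \<or> d \<noteq> 0" for a b c d
    using that P by (metis zero_index)
  show ?thesis
    using exhaust_4[of i]
  proof (elim disjE)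
    assume "i = 1"
    then show ?thesis using sys(1) nz k P by (intro exI[of _ "P 0 (k$2) (k$3) (k$1)"]) auto
  next
    assume "i = 2"
    then show ?thesis using sys(2) nz k P by (intro exI[of _ "P (k$2) 0 (k$1) (k$3)"]) auto
  next
    assume "i = 3"
    then show ?thesis using sys(3) nz k P by (intro exI[of _ "P (k$3) (- k$1) 0 (k$2)"]) auto
  next
    assume "i = 4"
    then show ?thesis using sys(4) nz k P by (intro exI[of _ "P (- k$1) (k$3) (k$2) 0"]) auto
  qed
qed

text \<open>The solutions form a nonzero complex subspace, of real dimension at least two. It is
  convex and not collinear, so it stays connected without the origin.\<close>

lemma connected_rapidity_eqs:
  assumes "on_conic k" "k \<noteq> 0"
  shows "connected {X. X \<noteq> 0 \<and> rapidity_eqs k X}"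
proof -
  have scale: "rapidity_eqs k (c *s X)" if "rapidity_eqs k X" for c X
  proof -
    have "s * (c * x) + t * (c * y) = u * (c * z)" if "s * x + t * y = u * z" for s t u x y z :: complex
      using that by algebra
    then show ?thesis
      using that by (simp add: rapidity_eqs_def)
  qed
  have add: "rapidity_eqs k (X + Y)" if "rapidity_eqs k X" "rapidity_eqs k Y" for X Y
    using that by (simp add: rapidity_eqs_def algebra_simps)
  have real: "r *\<^sub>R X = complex_of_real r *s X" for r and X :: "complex ^ 4"
    unfolding vec_eq_iff vector_scaleR_component vector_smult_component
    by (simp add: scaleR_conv_of_real)
  have conv: "convex {X. rapidity_eqs k X}"
    unfolding convex_def real by (auto intro: scale add)
  obtain X where X: "X \<noteq> 0" "rapidity_eqs k X"
    using rapidity_eqs_hyperplane[OF assms] by blast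
  \<comment> \<open>\<open>X\<close> and \<open>\<i> *s X\<close> are linearly independent over the
    reals.\<close>
  have "\<not> collinear {0, X, \<i> *s X}"
  proof
    assume "collinear {0, X, \<i> *s X}"
    then obtain r where "\<i> *s X = r *\<^sub>R X"
      using X(1) unfolding collinear_lemma by (auto simp: vec_eq_iff)
    moreover obtain j where "X $ j \<noteq> 0"
      using X(1) by (auto simp: vec_eq_iff)
    ultimately have "\<i> * X $ j = of_real r * X $ j"
      by (metis real vector_smult_component)
    then have "\<i> = of_real r"
      using \<open>X $ j \<noteq> 0\<close> by simp
    then show False
      by (simp add: complex_eq_iff)
  qed
  moreover have "{0, X, \<i> *s X} \<subseteq> {X. rapidity_eqs k X}"
    using X scale[of X 0] scale[of X \<i>] by (auto simp: rapidity_eqs_def)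
  ultimately have "\<not> collinear {X. rapidity_eqs k X}"
    using collinear_subset by blast
  then have "connected ({X. rapidity_eqs k X} - {0})"
    using conv by (intro connected_convex_diff_countable) auto
  moreover have "{X. rapidity_eqs k X} - {0} = {X. X \<noteq> 0 \<and> rapidity_eqs k X}"
    by auto
  ultimately show ?thesis by simp
qed

section \<open>Rapidity curves and the Fermat surface\<close>

lemma Lambda_eq: "Lambda = {p. on_conic (rep_proj p)}"
  by (simp add: Lambda_def on_conic_def Let_def)

lemma rapidity_curve_eq: "rapidity_curve N p = {q. rapidity_eqs (rep_proj p) (rep_proj q ^ N)}"
  by (simp add: rapidity_curve_def rapidity_eqs_def Let_def)

lemma fermat_surface_eq: "fermat_surface N = subvariety proj_forms {q. fermat_eq (rep_proj q ^ N)}"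
  by (simp add: fermat_surface_def fermat_eq_def Let_def mult.commute[of 2] power_mult)

lemma vec_power_eq_0_iff:
  fixes x :: "'a::idom ^ 'n"
  assumes "N > 0"
  shows "x ^ N = 0 \<longleftrightarrow> x = 0"
  using assms by (simp add: vec_eq_iff)

lemma vec_power_scale: "(c *s x) ^ N = (c ^ N) *s (x ^ N)" for x :: "'a::comm_ring_1 ^ 'n"
  by (simp add: vec_eq_iff power_mult_distrib)

lemma abs_proj_on_conic:
  assumes "k \<noteq> 0"
  shows "abs_proj k \<in> Lambda \<longleftrightarrow> on_conic k"
  using rep_abs_proj[OF assms] by (metis (mono_tags) Lambda_eq mem_Collect_eq on_conic_scale)

lemma mem_rapidity_curve_abs_proj_left:
  assumes "k \<noteq> 0"
  shows "q \<in> rapidity_curve N (abs_proj k) \<longleftrightarrow> rapidity_eqs k (rep_proj q ^ N)"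
proof -
  obtain c where "c \<noteq> 0" "rep_proj (abs_proj k) = c *s k"
    using rep_abs_proj[OF assms] .
  then show ?thesis
    using rapidity_eqs_scale[of c 1] by (simp add: rapidity_curve_eq)
qed

lemma mem_rapidity_curve_abs_proj_right:
  assumes "x \<noteq> 0"
  shows "abs_proj x \<in> rapidity_curve N p \<longleftrightarrow> rapidity_eqs (rep_proj p) (x ^ N)"
proof -
  obtain c where "c \<noteq> 0" "rep_proj (abs_proj x) = c *s x"
    using rep_abs_proj[OF assms] .
  then show ?thesis
    using rapidity_eqs_scale[of 1 "c ^ N"] by (simp add: rapidity_curve_eq vec_power_scale)
qed

lemma rapidity_curve_connected:
  assumes "N > 0" "p \<in> Lambda"
  shows "connectedin (ambient_zariski proj_forms) (rapidity_curve N p)"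
    and "rapidity_curve N p \<noteq> {}"
proof -
  let ?k = "rep_proj p"
  let ?Y = "{X. X \<noteq> 0 \<and> rapidity_eqs ?k X}"
  \<comment> \<open>\<open>C\<close> is the affine cone over the curve without its vertex, written
    as a preimage under the power map.\<close>
  define C where "C = {x :: complex ^ 4. x ^ N \<in> ?Y}"
  have k: "on_conic ?k" "?k \<noteq> 0"
    using assms(2) rep_proj_nonzero by (auto simp: Lambda_eq)
  have C: "x \<in> C \<longleftrightarrow> x \<noteq> 0 \<and> rapidity_eqs ?k (x ^ N)" for x
    using assms(1) by (simp add: C_def vec_power_eq_0_iff)
  have "connected C"
    unfolding C_def using rapidity_eqs_hyperplane[OF k]
    by (intro connected_power_vimage connected_rapidity_eqs k assms) auto
  then have "connectedin (top_of_set C) C"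
    by (simp add: connectedin_subtopology)
  then have "connectedin (ambient_zariski proj_forms) (abs_proj ` C)"
    by (rule connectedin_continuous_map_image[OF continuous_map_abs_proj, rotated]) (simp add: C)
  moreover have "abs_proj ` C = rapidity_curve N p"
  proof (intro equalityI subsetI)
    fix q assume "q \<in> rapidity_curve N p"
    then have "rep_proj q \<in> C"
      using rep_proj_nonzero by (simp add: C rapidity_curve_eq)
    then show "q \<in> abs_proj ` C"
      using abs_rep_proj by (metis image_eqI)
  qed (auto simp: C mem_rapidity_curve_abs_proj_right)
  ultimately show "connectedin (ambient_zariski proj_forms) (rapidity_curve N p)"
    by simp
  obtain X where "X \<noteq> 0" "rapidity_eqs ?k X"
    using rapidity_eqs_hyperplane[OF k] by blast
  moreover obtain x where "x ^ N = X"
    using ex_vec_root[OF assms(1)] by metis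
  ultimately have "x \<in> C"
    by (simp add: C_def)
  then show "rapidity_curve N p \<noteq> {}"
    using \<open>abs_proj ` C = rapidity_curve N p\<close> by blast
qed

section \<open>Construction of the projection to the conic\<close>

text \<open>All entries are quadratic in the \<open>N\<close>-th powers, so the three coordinates
  share the degree \<open>2 * N\<close>, as \<open>morphism_graph\<close> needs.\<close>

lemma row_products_homogeneous:
  assumes "v \<in> row_products"
  shows "homogeneous (2 * N) (\<lambda>x. v (x ^ N) $ i)"
proof -
  have pow: "homogeneous N (\<lambda>x. (x $ j) ^ N)" for j :: 4
    using homogeneous_power[OF homogeneous.coord] by simp
  have mult: "homogeneous (2 * N) (\<lambda>x. (x $ j) ^ N * (x $ l) ^ N)" for j l :: 4
    using homogeneous.mult[OF pow pow] by (simp add: mult_2)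
  from assms have "\<forall>i. homogeneous (2 * N) (\<lambda>x. v (x ^ N) $ i)"
    unfolding forall_3
  proof (cases rule: row_products_cases)
  qed (auto simp: power2_eq_square intro!: homogeneous.add homogeneous_diff mult)
  then show ?thesis ..
qed

lemma rapidity_curve_fermat:
  assumes "p \<in> Lambda" "q \<in> rapidity_curve N p"
  shows "fermat_eq (rep_proj q ^ N)"
  using assms fermat_eq_of_rapidity_eqs rep_proj_nonzero
  by (auto simp: Lambda_eq rapidity_curve_eq)

text \<open>Serves twice: for the uniqueness of the curve through \<open>q\<close> and as the local
  formula for the projection to the conic.\<close>

lemma rapidity_curve_row_product:
  assumes "v \<in> row_products" "v (rep_proj q ^ N) \<noteq> 0" "q \<in> rapidity_curve N p"
  shows "p = abs_proj (v (rep_proj q ^ N))"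
proof -
  obtain c where "rep_proj p = c *s v (rep_proj q ^ N)"
    using rapidity_eqs_unique[OF _ assms(1,2)] assms(3)
    by (auto simp: rapidity_curve_eq)
  then have "abs_proj (rep_proj p) = abs_proj (v (rep_proj q ^ N))"
    by (rule abs_proj_eqI[OF rep_proj_nonzero])
  then show ?thesis
    by (simp add: abs_rep_proj)
qed

lemma ex1_rapidity_curve:
  assumes "N > 0" "fermat_eq (rep_proj q ^ N)"
  shows "\<exists>!p. p \<in> Lambda \<and> q \<in> rapidity_curve N p"
proof -
  have "rep_proj q ^ N \<noteq> 0"
    using rep_proj_nonzero vec_power_eq_0_iff[OF assms(1)] by blast
  then obtain v where v: "v \<in> row_products" "v (rep_proj q ^ N) \<noteq> 0"
    using ex_row_product_nonzero assms(2) by blast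
  show ?thesis
  proof (rule ex1I)
    show "abs_proj (v (rep_proj q ^ N)) \<in> Lambda \<and> q \<in> rapidity_curve N (abs_proj (v (rep_proj q ^ N)))"
      using row_product_solves[OF v(1) assms(2)] v(2)
      by (simp add: abs_proj_on_conic mem_rapidity_curve_abs_proj_left)
  qed (use rapidity_curve_row_product[OF v] in blast)
qed

theorem proposition3p1:
  fixes N :: nat
  assumes "N \<ge> 2"
  shows "isomorphism (rapidity_family N) (fermat_surface N) snd \<and>
    (\<exists>\<pi>. fibration (fermat_surface N) conic_variety \<pi> \<and>
         (\<forall>x \<in> points (rapidity_family N). \<pi> (snd x) = fst x))"
proof -
  define S where "S = {q :: 4 proj. fermat_eq (rep_proj q ^ N)}"
  define W where "W = (SIGMA p:Lambda. rapidity_curve N p)"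
  \<comment> \<open>On \<open>S\<close> the description is well defined by
    \<open>ex1_rapidity_curve\<close>; values off \<open>S\<close> do not matter.\<close>
  define \<pi> where "\<pi> q = (THE p. p \<in> Lambda \<and> q \<in> rapidity_curve N p)" for q
  have N: "N > 0" using assms by simp
  have fam: "rapidity_family N = subvariety biproj_forms W"
    by (simp add: rapidity_family_def W_def)
  have surf: "fermat_surface N = subvariety proj_forms S"
    by (simp add: fermat_surface_eq S_def)
  have pts [simp]: "points (rapidity_family N) = W" "points (fermat_surface N) = S"
    "points conic_variety = Lambda"
    by (simp_all add: fam surf conic_variety_def points_subvariety)
  have \<pi>: "\<pi> q \<in> Lambda \<and> q \<in> rapidity_curve N (\<pi> q)" if "q \<in> S" for q
    using theI'[OF ex1_rapidity_curve[OF N]] that unfolding \<pi>_def S_def by blast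
  have \<pi>_eq: "\<pi> q = p" if "p \<in> Lambda" "q \<in> rapidity_curve N p" for p q
    using the1_equality[OF ex1_rapidity_curve[OF N]] rapidity_curve_fermat that
    unfolding \<pi>_def by blast
  have curve: "rapidity_curve N p \<subseteq> S" if "p \<in> Lambda" for p
    using rapidity_curve_fermat that by (auto simp: S_def)
  have fibre: "{q \<in> S. \<pi> q = p} = rapidity_curve N p" if "p \<in> Lambda" for p
    using \<pi> \<pi>_eq curve that by blast
  have snd: "morphism (rapidity_family N) (fermat_surface N) snd"
    unfolding fam surf by (rule morphism_snd) (use curve in \<open>fastforce simp: W_def\<close>)
  have graph: "morphism (fermat_surface N) (rapidity_family N) (\<lambda>q. (\<pi> q, q))"
    unfolding fam surf
  proof (rule morphism_graph)
    show "(\<lambda>q. (\<pi> q, q)) \<in> S \<rightarrow> W"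
      using \<pi> by (auto simp: W_def)
  next
    fix p assume p: "p \<in> S"
    then have "rep_proj p ^ N \<noteq> 0"
      using rep_proj_nonzero vec_power_eq_0_iff[OF N] by blast
    then obtain v where v: "v \<in> row_products" "v (rep_proj p ^ N) \<noteq> 0"
      using ex_row_product_nonzero p unfolding S_def by blast
    \<comment> \<open>The product \<open>v\<close> that is nonzero at \<open>p\<close> computes
      \<open>\<pi>\<close> wherever it does not vanish on \<open>S\<close>.\<close>
    show "\<exists>w m. (\<forall>i. homogeneous m (\<lambda>x. w x $ i)) \<and> w (rep_proj p) \<noteq> 0 \<and>
        (\<forall>q\<in>S. w (rep_proj q) \<noteq> 0 \<longrightarrow> \<pi> q = abs_proj (w (rep_proj q)))"
      using row_products_homogeneous[OF v(1)] v(2) rapidity_curve_row_product[OF v(1)] \<pi>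
      by (intro exI[of _ "\<lambda>x. v (x ^ N)"] exI[of _ "2 * N"]) blast
  qed
  have "isomorphism (rapidity_family N) (fermat_surface N) snd"
    unfolding isomorphism_def using snd graph \<pi>_eq
    by (intro conjI exI[of _ "\<lambda>q. (\<pi> q, q)"]) (auto simp: W_def)
  moreover have "morphism (rapidity_family N) conic_variety fst"
    unfolding fam conic_variety_def by (rule morphism_fst) (auto simp: W_def)
  \<comment> \<open>\<open>\<pi>\<close> is the inverse isomorphism
    \<open>q \<mapsto> (\<pi> q, q)\<close> followed by the first projection.\<close>
  from morphism_compose[OF graph this] have "morphism (fermat_surface N) conic_variety \<pi>"
    by (simp add: o_def)
  then have "fibration (fermat_surface N) conic_variety \<pi>"
    unfolding fibration_def
  proof (intro conjI ballI)
    show "\<pi> ` points (fermat_surface N) = points conic_variety"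
    proof (intro equalityI subsetI)
      fix p assume "p \<in> points conic_variety"
      then have "p \<in> Lambda" by simp
      then obtain q where "q \<in> S" "\<pi> q = p"
        using fibre rapidity_curve_connected(2)[OF N] by blast
      then show "p \<in> \<pi> ` points (fermat_surface N)" by auto
    qed (use \<pi> in auto)
  next
    fix p assume "p \<in> points conic_variety"
    \<comment> \<open>The fibre is a rapidity curve contained in \<open>S\<close>, so connectedness
      in the ambient space passes to the subspace topology of the surface.\<close>
    then show "connectedin (zariski (fermat_surface N)) {q \<in> points (fermat_surface N). \<pi> q = p}"
      using fibre curve rapidity_curve_connected(1)[OF N]
      by (simp add: surf subvariety_def connectedin_subtopology)
  qed
  moreover have "\<forall>x\<in>points (rapidity_family N). \<pi> (snd x) = fst x"
    using \<pi>_eq by (auto simp: W_def)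
  ultimately show ?thesis by blast
qed

end
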